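(* Let $h=(h_1,\ldots,h_{m_1})$ and $g=(g_1,\ldots,g_{m_2})$ be tuples of polynomials in $\mathbb{R}[x]=\mathbb{R}[x_1,\ldots,x_n]$, let $K=\{x\in\mathbb{R}^n: h(x)=0,\ g(x)\ge 0\}\neq\emptyset$, and let $\mathcal{A}\subseteq\mathbb{N}^n$ be finite. Suppose $\mathbb{R}[x]_{\mathcal{A}}$ is $K$-full and $I(h)+Q(g)$ is archimedean. Then $$\mathrm{int}\big(\mathscr{P}_{\mathcal{A}}(K)\big)\subseteq\bigcup_{k=1}^{\infty}\mathscr{Q}_{\mathcal{A}}^k(K)\subseteq\mathscr{P}_{\mathcal{A}}(K).$$
   Context: $\mathbb{N}$ is the set of nonnegative integers; $\mathbb{R}[x]_d$ is the space of polynomials of degree at most $d$ (equal to $\{0\}$ for $d<0$). $\mathbb{R}[x]_{\mathcal{A}}=\mathrm{span}\{x^\alpha:\alpha\in\mathcal{A}\}$; it is $K$-full if some $p\in\mathbb{R}[x]_{\mathcal{A}}$ is positive on $K$. $\mathscr{P}_{\mathcal{A}}(K)=\{p\in\mathbb{R}[x]_{\mathcal{A}}:p(u)\ge0\ \forall u\in K\}$, with interior taken in $\mathbb{R}[x]_{\mathcal{A}}$. $\Sigma_{n,d}$ is the cone of sums of squares of polynomials in $\mathbb{R}[x]$ of degree at most $d$ ($\{0\}$ for $d<0$). Truncated ideal and quadratic module: $I_{\ell}(h)=h_1\mathbb{R}[x]_{\ell-\deg(h_1)}+\cdots+h_{m_1}\mathbb{R}[x]_{\ell-\deg(h_{m_1})}$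 and $Q_k(g)=\Sigma_{n,2k}+g_1\Sigma_{n,2k-\deg(g_1)}+\cdots+g_{m_2}\Sigma_{n,2k-\deg(g_{m_2})}$; $I(h)=\bigcup_k I_{2k}(h)$, $Q(g)=\bigcup_kQ_k(g)$. $I(h)+Q(g)$ is archimedean if $R-\|x\|_2^2\in I(h)+Q(g)$ for some $R>0$. $\mathscr{Q}_{\mathcal{A}}^k(K)=\{p\in\mathbb{R}[x]_{\mathcal{A}}: p\in Q_k(g)+I_{2k}(h)\}$. *)

theory Defs
  imports "HOL-Analysis.Analysis" "HOL-Analysis.Finite_Function_Topology"
begin

text \<open>
  The ring \<open>\<real>[x\<^sub>1, \<dots>, x\<^sub>n]\<close>, with variables indexed by a finite type \<open>'n\<close>: a polynomial is the
  finitely supported map from exponents to coefficients. The ring structure is the one of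
  \<open>Poly_Mapping\<close> (convolution product); the real vector space structure and the norm (sum of the
  absolute values of the coefficients) are those of \<open>Finite_Function_Topology\<close>.
\<close>

type_synonym 'n rpoly = "('n \<Rightarrow>\<^sub>0 nat) \<Rightarrow>\<^sub>0 real"

definition monom_deg :: "('n::finite \<Rightarrow>\<^sub>0 nat) \<Rightarrow> nat" where
  "monom_deg \<alpha> = (\<Sum>i\<in>UNIV. Poly_Mapping.lookup \<alpha> i)"

definition monomial :: "('n::finite \<Rightarrow>\<^sub>0 nat) \<Rightarrow> 'n rpoly" where
  "monomial \<alpha> = Poly_Mapping.single \<alpha> 1"

definition const_poly :: "real \<Rightarrow> 'n::finite rpoly" where
  "const_poly c = Poly_Mapping.single 0 c"

definition var_poly :: "'n::finite \<Rightarrow> 'n rpoly" where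
  "var_poly i = monomial (Poly_Mapping.single i 1)"

definition eval_poly :: "'n::finite rpoly \<Rightarrow> real ^ 'n \<Rightarrow> real" where
  "eval_poly p u = (\<Sum>\<alpha>\<in>Poly_Mapping.keys p. Poly_Mapping.lookup p \<alpha> * (\<Prod>i\<in>UNIV. (u $ i) ^ Poly_Mapping.lookup \<alpha> i))"

text \<open>
  The zero polynomial gets degree \<open>0\<close>. This choice is immaterial below: \<open>polys_upto\<close> treats \<open>0\<close>
  separately, and elsewhere the degree only bounds the multipliers of the polynomial itself.
\<close>

definition total_deg :: "'n::finite rpoly \<Rightarrow> nat" where
  "total_deg p = (if p = 0 then 0 else Max (monom_deg ` Poly_Mapping.keys p))"

text \<open>The degree bound is an integer, so that \<open>polys_upto d = {0}\<close> for \<open>d < 0\<close>.\<close>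

definition polys_upto :: "int \<Rightarrow> 'n::finite rpoly set" where
  "polys_upto d = {p. p = 0 \<or> int (total_deg p) \<le> d}"

definition sos :: "'n::finite rpoly set" where
  "sos = {(\<Sum>i<m. (q i)\<^sup>2) | (m::nat) q. True}"

definition sos_upto :: "int \<Rightarrow> 'n::finite rpoly set" where
  "sos_upto d = sos \<inter> polys_upto d"

definition trunc_ideal :: "nat \<Rightarrow> 'n::finite rpoly list \<Rightarrow> 'n rpoly set" where
  "trunc_ideal l h =
     {(\<Sum>j<length h. h ! j * q j) | q.
        \<forall>j<length h. q j \<in> polys_upto (int l - int (total_deg (h ! j)))}"

definition trunc_qmodule :: "nat \<Rightarrow> 'n::finite rpoly list \<Rightarrow> 'n rpoly set" where
  "trunc_qmodule k g =
     {\<sigma>\<^sub>0 + (\<Sum>j<length g. g ! j * \<sigma> j) | \<sigma>\<^sub>0 \<sigma>.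
        \<sigma>\<^sub>0 \<in> sos_upto (2 * int k) \<and>
        (\<forall>j<length g. \<sigma> j \<in> sos_upto (2 * int k - int (total_deg (g ! j))))}"

definition poly_ideal :: "'n::finite rpoly list \<Rightarrow> 'n rpoly set" where
  "poly_ideal h = (\<Union>k. trunc_ideal (2 * k) h)"

definition qmodule :: "'n::finite rpoly list \<Rightarrow> 'n rpoly set" where
  "qmodule g = (\<Union>k. trunc_qmodule k g)"

definition archimedean_pair :: "'n::finite rpoly list \<Rightarrow> 'n rpoly list \<Rightarrow> bool" where
  "archimedean_pair h g \<longleftrightarrow>
     (\<exists>R>0. const_poly R - (\<Sum>i\<in>UNIV. (var_poly i)\<^sup>2) \<in> {p + q | p q. p \<in> poly_ideal h \<and> q \<in> qmodule g})"

definition semialg_set :: "'n::finite rpoly list \<Rightarrow> 'n rpoly list \<Rightarrow> (real ^ 'n) set" where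
  "semialg_set h g =
     {u. (\<forall>j<length h. eval_poly (h ! j) u = 0) \<and> (\<forall>j<length g. eval_poly (g ! j) u \<ge> 0)}"

definition polys_supp :: "('n::finite \<Rightarrow>\<^sub>0 nat) set \<Rightarrow> 'n rpoly set" where
  "polys_supp A = span (monomial ` A)"

definition full_on :: "('n::finite \<Rightarrow>\<^sub>0 nat) set \<Rightarrow> (real ^ 'n) set \<Rightarrow> bool" where
  "full_on A K \<longleftrightarrow> (\<exists>p\<in>polys_supp A. \<forall>u\<in>K. eval_poly p u > 0)"

definition nonneg_cone :: "('n::finite \<Rightarrow>\<^sub>0 nat) set \<Rightarrow> (real ^ 'n) set \<Rightarrow> 'n rpoly set" where
  "nonneg_cone A K = {p \<in> polys_supp A. \<forall>u\<in>K. eval_poly p u \<ge> 0}"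

definition qmodule_cone ::
    "('n::finite \<Rightarrow>\<^sub>0 nat) set \<Rightarrow> 'n rpoly list \<Rightarrow> 'n rpoly list \<Rightarrow> nat \<Rightarrow> 'n rpoly set" where
  "qmodule_cone A h g k =
     {p \<in> polys_supp A. p \<in> {q + r | q r. q \<in> trunc_qmodule k g \<and> r \<in> trunc_ideal (2 * k) h}}"

end

theory Submission
  imports Defs
begin

text \<open>
  A polynomial in the interior of the cone is positive on \<open>K\<close>, because a small multiple of a
  polynomial positive on \<open>K\<close> can be subtracted from it; so the first inclusion is Putinar's
  Positivstellensatz, for which we follow Jacobi's algebraic argument. Let \<open>M = I(h) + Q(g)\<close> and
  suppose that \<open>-1 \<notin> M - \<Sigma> p\<close>. By Zorn's lemma this quadratic module is contained in a maximal
  proper one, which is a total order up to its support; since it is archimedean, sending each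
  polynomial to the real number from which it differs by an infinitesimal is a ring homomorphism to
  \<open>\<real>\<close>. It is the evaluation at a point of \<open>K\<close> where \<open>p \<le> 0\<close>. Hence if \<open>p > 0\<close> on \<open>K\<close> then
  \<open>s p - 1 \<in> M\<close> for some sum of squares \<open>s\<close>, and the archimedean property allows one to divide by
  \<open>s\<close>.
\<close>

section \<open>Archimedean quadratic modules in commutative real algebras\<close>

text \<open>The whole ring is allowed; properness is expressed separately as
  \<open>-1 \<notin> M\<close>.\<close>

definition quadratic_module :: "'a::comm_ring_1 set \<Rightarrow> bool" where
  "quadratic_module M \<longleftrightarrow>
     1 \<in> M \<and> (\<forall>a\<in>M. \<forall>b\<in>M. a + b \<in> M) \<and> (\<forall>a. \<forall>b\<in>M. a\<^sup>2 * b \<in> M)"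

text \<open>Adding one square at a time makes closure properties provable by rule induction;
  \<open>sos_eq_sums_of_squares\<close> gives the link to \<open>sos\<close>.\<close>

inductive_set sums_of_squares :: "'a::comm_ring_1 set" where
  zero: "0 \<in> sums_of_squares"
| add_square: "s \<in> sums_of_squares \<Longrightarrow> s + a\<^sup>2 \<in> sums_of_squares"

text \<open>Applied to both \<open>a\<close> and \<open>-a\<close>, the condition bounds every
  element by constants on both sides.\<close>

definition archimedean_module :: "'a::{comm_ring_1,real_algebra_1} set \<Rightarrow> bool" where
  "archimedean_module M \<longleftrightarrow> (\<forall>a. \<exists>r. of_real r - a \<in> M)"

definition real_character :: "('a::{comm_ring_1,real_algebra_1} \<Rightarrow> real) \<Rightarrow> bool" where
  "real_character f \<longleftrightarrow> (\<forall>a b. f (a + b) = f a + f b) \<and> (\<forall>a b. f (a * b) = f a * f b) \<and>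
     (\<forall>r. f (of_real r) = r)"

lemma
  assumes "real_character f"
  shows real_character_add: "f (a + b) = f a + f b"
    and real_character_mult: "f (a * b) = f a * f b"
    and real_character_of_real: "f (of_real r) = r"
    and real_character_zero: "f 0 = 0"
    and real_character_one: "f 1 = 1"
  using assms unfolding real_character_def by (blast, blast, blast, metis of_real_0, metis of_real_1)

lemma real_character_minus: "real_character f \<Longrightarrow> f (- a) = - f a"
  using real_character_add[of f a "- a"] by (simp add: real_character_zero)

lemma real_character_power: "real_character f \<Longrightarrow> f (a ^ n) = f a ^ n"
  by (induction n) (simp_all add: real_character_mult real_character_one)

lemma real_character_sum: "real_character f \<Longrightarrow> f (\<Sum>i\<in>S. a i) = (\<Sum>i\<in>S. f (a i))"
  by (induction S rule: infinite_finite_induct) (simp_all add: real_character_add real_character_zero)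

lemma real_character_prod: "real_character f \<Longrightarrow> f (\<Prod>i\<in>S. a i) = (\<Prod>i\<in>S. f (a i))"
  by (induction S rule: infinite_finite_induct) (simp_all add: real_character_mult real_character_one)

lemma of_real_inverse_mult:
  assumes "r \<noteq> 0"
  shows "of_real (1 / r) * (of_real r * a) = (a :: 'a::real_algebra_1)"
proof -
  have "of_real (1 / r) * (of_real r * a) = of_real (1 / r * r) * a"
    by (simp only: of_real_mult mult.assoc)
  with assms show ?thesis by simp
qed

lemma square_in_sums_of_squares: "a\<^sup>2 \<in> sums_of_squares"
  using sums_of_squares.add_square[OF sums_of_squares.zero, of a] by simp

lemma sums_of_squares_add:
  assumes "s \<in> sums_of_squares" "t \<in> sums_of_squares"
  shows "s + t \<in> sums_of_squares"
  using assms(2)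
  by induction (use assms(1) in \<open>auto simp flip: add.assoc intro: sums_of_squares.intros\<close>)

lemma sums_of_squares_mult_square:
  assumes "s \<in> sums_of_squares"
  shows "a\<^sup>2 * s \<in> sums_of_squares"
  using assms
proof induction
  case (add_square s b)
  have "a\<^sup>2 * (s + b\<^sup>2) = a\<^sup>2 * s + (a * b)\<^sup>2"
    by (simp add: algebra_simps power_mult_distrib)
  with add_square show ?case
    by (simp add: sums_of_squares.add_square)
qed (simp add: sums_of_squares.zero)

lemma real_character_sums_of_squares:
  assumes "real_character f" "s \<in> sums_of_squares"
  shows "f s \<ge> 0"
  using assms(2) by induction (simp_all add: real_character_zero real_character_add real_character_power assms(1))

context
  fixes M :: "'a::comm_ring_1 set"
  assumes M: "quadratic_module M"
begin

lemma quadratic_module_one: "1 \<in> M"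
  and quadratic_module_add: "a \<in> M \<Longrightarrow> b \<in> M \<Longrightarrow> a + b \<in> M"
  and quadratic_module_mult_square: "b \<in> M \<Longrightarrow> a\<^sup>2 * b \<in> M"
  using M by (auto simp: quadratic_module_def)

lemma quadratic_module_square: "a\<^sup>2 \<in> M"
  using quadratic_module_mult_square[OF quadratic_module_one] by simp

lemma quadratic_module_zero: "0 \<in> M"
  using quadratic_module_square[of 0] by simp

lemma quadratic_module_mult_sums_of_squares:
  assumes "s \<in> sums_of_squares" "m \<in> M"
  shows "s * m \<in> M"
  using assms(1)
proof induction
  case (add_square s a)
  then show ?case
    by (simp add: distrib_right quadratic_module_add quadratic_module_mult_square assms(2))
qed (simp add: quadratic_module_zero)

lemma sums_of_squares_subset_quadratic_module: "s \<in> sums_of_squares \<Longrightarrow> s \<in> M"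
  using quadratic_module_mult_sums_of_squares[OF _ quadratic_module_one] by simp

text \<open>This is the smallest quadratic module containing \<open>M\<close> and \<open>a\<close>.
  It serves to exploit maximality and, with \<open>-p\<close> for \<open>a\<close>, to test whether
  \<open>p\<close> can be made nonpositive.\<close>

lemma quadratic_module_adjoin:
  "quadratic_module {m + s * a | m s. m \<in> M \<and> s \<in> sums_of_squares}" (is "quadratic_module ?N")
proof -
  have "1 \<in> ?N"
    using quadratic_module_one sums_of_squares.zero by force
  moreover have "x + y \<in> ?N" if xy: "x \<in> ?N" "y \<in> ?N" for x y
  proof -
    from xy obtain m s m' s' where *: "x = m + s * a" "y = m' + s' * a" "m \<in> M" "m' \<in> M"
      "s \<in> sums_of_squares" "s' \<in> sums_of_squares" by blast
    then have "x + y = (m + m') + (s + s') * a" by (simp add: algebra_simps)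
    with * show ?thesis using quadratic_module_add sums_of_squares_add by blast
  qed
  moreover have "b\<^sup>2 * x \<in> ?N" if x: "x \<in> ?N" for b x
  proof -
    from x obtain m s where *: "x = m + s * a" "m \<in> M" "s \<in> sums_of_squares" by blast
    then have "b\<^sup>2 * x = b\<^sup>2 * m + (b\<^sup>2 * s) * a" by (simp add: algebra_simps)
    with * show ?thesis
      using quadratic_module_mult_square sums_of_squares_mult_square by blast
  qed
  ultimately show ?thesis unfolding quadratic_module_def by blast
qed

end

section \<open>Maximal proper quadratic modules\<close>

text \<open>Zorn's lemma applies because two elements of the union of a chain lie in a common
  member, and a union of sets avoiding \<open>-1\<close> avoids it too.\<close>

lemma exists_maximal_quadratic_module:
  fixes M :: "'a::comm_ring_1 set"
  assumes "quadratic_module M" "-1 \<notin> M"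
  obtains Q where "quadratic_module Q" "M \<subseteq> Q" "-1 \<notin> Q"
    "\<And>N. quadratic_module N \<Longrightarrow> Q \<subseteq> N \<Longrightarrow> -1 \<notin> N \<Longrightarrow> N = Q"
proof -
  let ?S = "{N. quadratic_module N \<and> M \<subseteq> N \<and> -1 \<notin> N}"
  have "\<exists>Q\<in>?S. \<forall>N\<in>?S. Q \<subseteq> N \<longrightarrow> N = Q"
  proof (rule subset_Zorn_nonempty)
    show "?S \<noteq> {}" using assms by blast
    fix C assume C: "C \<noteq> {}" "subset.chain ?S C"
    have qm: "quadratic_module N" if "N \<in> C" for N
      using C that by (auto simp: subset_chain_def)
    have "a + b \<in> \<Union>C" if "a \<in> \<Union>C" "b \<in> \<Union>C" for a b
    proof -
      from that obtain N N' where "N \<in> C" "N' \<in> C" "a \<in> N" "b \<in> N'" by blast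
      moreover have "N \<subseteq> N' \<or> N' \<subseteq> N" using C calculation by (auto simp: subset_chain_def)
      ultimately show ?thesis using quadratic_module_add[OF qm] by blast
    qed
    moreover have "a\<^sup>2 * b \<in> \<Union>C" if "b \<in> \<Union>C" for a b
      using that quadratic_module_mult_square[OF qm] by blast
    moreover have "1 \<in> \<Union>C"
      using C quadratic_module_one[OF qm] by blast
    ultimately have "quadratic_module (\<Union>C)"
      unfolding quadratic_module_def by blast
    then show "\<Union>C \<in> ?S"
      using C by (auto simp: subset_chain_def)
  qed
  then obtain Q where Q: "Q \<in> ?S" and max: "\<forall>N\<in>?S. Q \<subseteq> N \<longrightarrow> N = Q"
    by (rule bexE)
  show thesis
  proof (rule that)
    show "quadratic_module Q" "M \<subseteq> Q" "-1 \<notin> Q" using Q by auto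
    fix N assume "quadratic_module N" "Q \<subseteq> N" "-1 \<notin> N"
    moreover from this have "N \<in> ?S" using \<open>M \<subseteq> Q\<close> by auto
    ultimately show "N = Q" using max by simp
  qed
qed

context
  fixes M :: "'a::{comm_ring_1,real_algebra_1} set"
  assumes M: "quadratic_module M"
begin

text \<open>A nonnegative real is the square of a real constant.\<close>

lemma quadratic_module_scale:
  assumes "r \<ge> 0" "a \<in> M"
  shows "of_real r * a \<in> M"
proof -
  have "of_real r = (of_real (sqrt r))\<^sup>2"
    using assms(1) by (simp flip: of_real_power)
  then show ?thesis
    using quadratic_module_mult_square[OF M assms(2)] by metis
qed

lemma quadratic_module_scale_cancel:
  assumes "r > 0" "of_real r * a \<in> M"
  shows "a \<in> M"
  using quadratic_module_scale[of "1 / r", OF _ assms(2)] assms(1)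
  by (simp only: of_real_inverse_mult[OF less_imp_neq[symmetric]]) simp

lemma quadratic_module_of_real: "r \<ge> 0 \<Longrightarrow> of_real r \<in> M"
  using quadratic_module_scale[OF _ quadratic_module_one[OF M]] by simp

text \<open>A negative constant could be scaled by \<open>-1 / r\<close> to \<open>-1\<close>. This
  turns memberships of constants into inequalities between reals.\<close>

lemma proper_quadratic_module_of_real:
  assumes "-1 \<notin> M" "of_real r \<in> M"
  shows "r \<ge> 0"
proof (rule ccontr)
  assume "\<not> r \<ge> 0"
  then have "of_real (-1 / r) * of_real r \<in> M"
    by (intro quadratic_module_scale assms) (simp add: field_simps)
  also have "of_real (-1 / r) * of_real r = (of_real (-1) :: 'a)"
    using \<open>\<not> r \<ge> 0\<close> by (simp only: of_real_mult[symmetric]) simp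
  finally show False using assms(1) by simp
qed

text \<open>A product of two elements of a quadratic module need not belong to it, but
  \<open>(r + a)\<^sup>2 (r - a) + (r - a)\<^sup>2 (r + a) = 2 r (r\<^sup>2 - a\<^sup>2)\<close>.\<close>

lemma quadratic_module_bound_square:
  assumes "r > 0" "of_real r + a \<in> M" "of_real r - a \<in> M"
  shows "of_real (r\<^sup>2) - a\<^sup>2 \<in> M"
proof -
  let ?r = "of_real r :: 'a"
  have "(?r + a)\<^sup>2 * (?r - a) + (?r - a)\<^sup>2 * (?r + a) \<in> M"
    by (intro quadratic_module_add[OF M] quadratic_module_mult_square[OF M] assms)
  also have "(?r + a)\<^sup>2 * (?r - a) + (?r - a)\<^sup>2 * (?r + a) = of_real (2 * r) * (?r\<^sup>2 - a\<^sup>2)"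
    by (simp add: algebra_simps power2_eq_square)
  finally have "?r\<^sup>2 - a\<^sup>2 \<in> M"
    by (rule quadratic_module_scale_cancel[rotated]) (use assms(1) in simp)
  then show ?thesis by simp
qed

text \<open>If neither \<open>a\<close> nor \<open>-a\<close> lies in \<open>M\<close>, maximality gives \<open>-1 = m + s a = m' - t a\<close> with
  \<open>s\<close>, \<open>t\<close> sums of squares. Eliminating \<open>a\<close> puts \<open>s\<close> into the ideal \<open>M \<inter> -M\<close>, so that
  \<open>s a \<in> M\<close> and hence \<open>-1 \<in> M\<close>.\<close>

lemma maximal_quadratic_module_total:
  assumes proper: "-1 \<notin> M"
    and max: "\<And>N. quadratic_module N \<Longrightarrow> M \<subseteq> N \<Longrightarrow> -1 \<notin> N \<Longrightarrow> N = M"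
  shows "a \<in> M \<or> -a \<in> M"
proof (rule ccontr)
  assume neg: "\<not> ?thesis"
  have adjoin: "\<exists>m\<in>M. \<exists>s\<in>sums_of_squares. -1 = m + s * b" if "b \<notin> M" for b
  proof -
    let ?N = "{m + s * b | m s. m \<in> M \<and> s \<in> sums_of_squares}"
    have "M \<subseteq> ?N" using sums_of_squares.zero by force
    moreover have "0 + 1\<^sup>2 * b \<in> ?N"
      using quadratic_module_zero[OF M] square_in_sums_of_squares by blast
    \<comment> \<open>By maximality, a proper \<open>?N\<close> would equal \<open>M\<close> and so
      put \<open>b\<close> into \<open>M\<close>.\<close>
    moreover have "?N = M" if "-1 \<notin> ?N"
      using max[OF quadratic_module_adjoin[OF M]] \<open>M \<subseteq> ?N\<close> that .
    ultimately have "-1 \<in> ?N"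
      using that by fastforce
    then show ?thesis by blast
  qed
  from adjoin neg obtain m s m' t where
    ms: "m \<in> M" "s \<in> sums_of_squares" "-1 = m + s * a" and
    mt: "m' \<in> M" "t \<in> sums_of_squares" "-1 = m' + t * (-a)" by meson
  \<comment> \<open>Multiply the first equation by \<open>t\<close> and the second by
    \<open>s\<close>: the terms in \<open>s * t * a\<close> cancel.\<close>
  have "t * (-1) + s * (-1) = t * m + s * m'"
    using ms(3) mt(3) by (simp add: algebra_simps)
  then have "- s = t * m + s * m' + t"
    by (simp add: algebra_simps)
  then have minus_s: "-s \<in> M"
    using ms mt by (simp add: quadratic_module_add[OF M] quadratic_module_mult_sums_of_squares[OF M]
        sums_of_squares_subset_quadratic_module[OF M])
  \<comment> \<open>Since both \<open>s\<close> and \<open>-s\<close> lie in \<open>M\<close>, the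
    identity \<open>(a + 1)\<^sup>2 - (a - 1)\<^sup>2 = 4 * a\<close> yields
    \<open>4 * s * a\<close>.\<close>
  have "((a + 1)\<^sup>2 * s + (a - 1)\<^sup>2 * (- s)) \<in> M"
    by (intro quadratic_module_add[OF M] quadratic_module_mult_square[OF M] minus_s
        sums_of_squares_subset_quadratic_module[OF M] ms)
  also have "(a + 1)\<^sup>2 * s + (a - 1)\<^sup>2 * (- s) = of_real 4 * (s * a)"
    by (simp add: algebra_simps power2_eq_square)
  finally have "s * a \<in> M"
    by (rule quadratic_module_scale_cancel[rotated]) simp
  then show False
    using ms proper quadratic_module_add[OF M] by metis
qed

end

section \<open>The representation theorem for archimedean quadratic modules\<close>

text \<open>\<open>f\<close> is the standard part map: \<open>J\<close> is a subspace closed under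
  products, contains no nonzero constant, and every element differs from a constant by an element of
  \<open>J\<close>.\<close>

lemma exists_character:
  fixes M :: "'a::{comm_ring_1,real_algebra_1} set"
  assumes "quadratic_module M" "archimedean_module M" "-1 \<notin> M"
  obtains f where "real_character f" "\<And>a. a \<in> M \<Longrightarrow> f a \<ge> 0"
proof -
  obtain Q where Q: "quadratic_module Q" "M \<subseteq> Q" "-1 \<notin> Q"
    and max: "\<And>N. quadratic_module N \<Longrightarrow> Q \<subseteq> N \<Longrightarrow> -1 \<notin> N \<Longrightarrow> N = Q"
    using exists_maximal_quadratic_module[OF assms(1,3)] by metis
  note Q_add = quadratic_module_add[OF Q(1)]
  note Q_real = proper_quadratic_module_of_real[OF Q(1,3)]
  \<comment> \<open>\<open>J\<close> consists of the infinitesimals for the order with positive cone \<open>Q\<close>.\<close>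
  define J where "J = {a. \<forall>e>0. of_real e + a \<in> Q \<and> of_real e - a \<in> Q}"
  have J_zero: "0 \<in> J"
    by (auto simp: J_def intro: quadratic_module_of_real[OF Q(1)])
  have J_add: "a + b \<in> J" if "a \<in> J" "b \<in> J" for a b
    unfolding J_def
  proof (intro CollectI allI impI conjI)
    fix e :: real assume "e > 0"
    then have "of_real (e/2) + a \<in> Q" "of_real (e/2) + b \<in> Q"
      "of_real (e/2) - a \<in> Q" "of_real (e/2) - b \<in> Q"
      using that unfolding J_def by (metis (mono_tags, lifting) mem_Collect_eq half_gt_zero)+
    from Q_add[OF this(1,2)] Q_add[OF this(3,4)]
    have "of_real (e/2 + e/2) + (a + b) \<in> Q" "of_real (e/2 + e/2) - (a + b) \<in> Q"
      unfolding of_real_add by (simp_all add: algebra_simps)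
    then show "of_real e + (a + b) \<in> Q" "of_real e - (a + b) \<in> Q"
      by simp_all
  qed
  have J_minus: "- a \<in> J" if "a \<in> J" for a
    using that by (simp add: J_def)
  have J_scale_pos: "of_real c * a \<in> J" if "a \<in> J" "c > 0" for a c
    unfolding J_def
  proof (intro CollectI allI impI conjI)
    fix e :: real assume "e > 0"
    then have "of_real (e/c) + a \<in> Q" "of_real (e/c) - a \<in> Q"
      using that by (auto simp: J_def simp del: of_real_divide)
    then have "of_real c * (of_real (e/c) + a) \<in> Q" "of_real c * (of_real (e/c) - a) \<in> Q"
      using that by (auto intro!: quadratic_module_scale[OF Q(1)] simp del: of_real_divide)
    moreover have "of_real c * of_real (e/c) = (of_real e :: 'a)"
      using that by (simp flip: of_real_mult)
    ultimately show "of_real e + of_real c * a \<in> Q" "of_real e - of_real c * a \<in> Q"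
      by (simp_all only: distrib_left right_diff_distrib)
  qed
  have J_scale: "of_real c * a \<in> J" if "a \<in> J" for a c
    using J_scale_pos[OF that, of c] J_minus[OF J_scale_pos[OF that, of "-c"]] J_zero
    by (cases c "0::real" rule: linorder_cases) auto
  have J_square: "a\<^sup>2 \<in> J" if "a \<in> J" for a
    unfolding J_def
  proof (intro CollectI allI impI conjI)
    fix e :: real assume e: "e > 0"
    show "of_real e + a\<^sup>2 \<in> Q"
      using e by (intro Q_add quadratic_module_of_real quadratic_module_square Q) auto
    \<comment> \<open>The bound on squares is applied with radius \<open>sqrt e\<close>, which is
      admissible because \<open>a\<close> is infinitesimal.\<close>
    have "of_real ((sqrt e)\<^sup>2) - a\<^sup>2 \<in> Q"
      using that e by (intro quadratic_module_bound_square Q) (auto simp: J_def)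
    then show "of_real e - a\<^sup>2 \<in> Q" using e by simp
  qed
  have J_mult: "a * b \<in> J" if "a \<in> J" "b \<in> J" for a b
  proof -
    \<comment> \<open>Polarization reduces products to squares.\<close>
    have "of_real (1/4) * ((a + b)\<^sup>2 + - (a + - b)\<^sup>2) \<in> J"
      by (intro J_scale J_add J_minus J_square that)
    also have "(a + b)\<^sup>2 + - (a + - b)\<^sup>2 = of_real 4 * (a * b)"
      by (simp add: algebra_simps power2_eq_square)
    finally show ?thesis by (simp only: of_real_inverse_mult)
  qed
  have J_real: "c = 0" if "of_real c \<in> J" for c
  proof -
    \<comment> \<open>For negative \<open>c\<close> the tolerance \<open>- c / 2\<close> would put
      the negative constant \<open>c / 2\<close> into \<open>Q\<close>. The claim is then used for
      \<open>c\<close> and \<open>-c\<close>.\<close>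
    have "c \<ge> 0" if "of_real c \<in> J" for c :: real
    proof (rule ccontr)
      assume "\<not> c \<ge> 0"
      then have "of_real (- c / 2) + of_real c \<in> Q"
        using that unfolding J_def by (auto simp del: of_real_divide of_real_minus)
      then have "- c / 2 + c \<ge> 0" by (intro Q_real) (simp only: of_real_add)
      with \<open>\<not> c \<ge> 0\<close> show False by simp
    qed
    from this[OF that] this[of "-c"] J_minus[OF that] show ?thesis by simp
  qed
  have "\<exists>c. a - of_real c \<in> J" for a
  proof -
    obtain u l where u: "of_real u - a \<in> Q" and l: "of_real l - (- a) \<in> Q"
      using assms(2) Q(2) unfolding archimedean_module_def by blast
    \<comment> \<open>\<open>S\<close> is the upper cut of \<open>a\<close> in the reals, and its
      infimum is the required constant.\<close>
    define S where "S = {r. of_real r - a \<in> Q}"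
    have "u \<in> S" using u by (simp add: S_def)
    \<comment> \<open>Adding \<open>l + a\<close> and \<open>r - a\<close> leaves the constant
      \<open>l + r\<close> in \<open>Q\<close>.\<close>
    have "- l \<le> r" if "r \<in> S" for r
      using Q_add[OF l, of "of_real r - a"] Q_real[of "l + r"] that by (simp add: S_def)
    then have bdd: "bdd_below S" by (auto simp: bdd_below_def)
    have "a - of_real (Inf S) \<in> J"
      unfolding J_def
    proof (intro CollectI allI impI conjI)
      fix e :: real assume e: "e > 0"
      \<comment> \<open>Below the infimum, membership in \<open>Q\<close> fails, so totality of
        \<open>Q\<close> gives membership of the negative.\<close>
      then have "Inf S - e \<notin> S" using cInf_lower[OF _ bdd, of "Inf S - e"] by auto
      then have "- (of_real (Inf S - e) - a) \<in> Q"
        using maximal_quadratic_module_total[OF Q(1,3) max] unfolding S_def by blast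
      then show "of_real e + (a - of_real (Inf S)) \<in> Q" by (simp add: algebra_simps)
      obtain r where r: "r \<in> S" "r < Inf S + e"
        using e \<open>u \<in> S\<close> cInf_lessD[of S "Inf S + e"] by auto
      then have "(of_real r - a) + of_real (Inf S + e - r) \<in> Q"
        by (intro Q_add quadratic_module_of_real[OF Q(1)]) (auto simp: S_def)
      then show "of_real e - (a - of_real (Inf S)) \<in> Q" by (simp add: algebra_simps)
    qed
    then show ?thesis ..
  qed
  then obtain f where f: "\<And>a. a - of_real (f a) \<in> J" by metis
  \<comment> \<open>The constant is unique, so each homomorphism law reduces to showing that a
    difference lies in \<open>J\<close>.\<close>
  have f_eqI: "f a = c" if "a - of_real c \<in> J" for a c
    using J_real[of "f a - c"] J_add[OF that J_minus[OF f[of a]]] by simp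
  have "real_character f"
    unfolding real_character_def
  proof (intro conjI allI f_eqI)
    fix a b
    show "a + b - of_real (f a + f b) \<in> J"
      using J_add[OF f f, of a b] by (simp add: algebra_simps)
    \<comment> \<open>Expand \<open>a * b\<close> around \<open>f a\<close> and \<open>f b\<close>;
      the sum equals \<open>a * b - f a * f b\<close>.\<close>
    have "(a - of_real (f a)) * (b - of_real (f b)) + of_real (f a) * (b - of_real (f b))
      + of_real (f b) * (a - of_real (f a)) \<in> J"
      by (intro J_add J_mult J_scale f)
    then show "a * b - of_real (f a * f b) \<in> J" by (simp add: algebra_simps)
  qed (simp add: J_zero)
  moreover have "f a \<ge> 0" if "a \<in> M" for a
  proof (rule ccontr)
    assume "\<not> f a \<ge> 0"
    \<comment> \<open>With tolerance \<open>- f a / 2\<close>, adding \<open>a\<close> leaves the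
      negative constant \<open>f a / 2\<close> in \<open>Q\<close>.\<close>
    then have "of_real (- f a / 2) - (a - of_real (f a)) \<in> Q"
      using f[of a] unfolding J_def by (auto simp del: of_real_divide of_real_minus)
    then have "of_real (- f a / 2) - (a - of_real (f a)) + a \<in> Q"
      using that Q by (intro Q_add) auto
    then have "of_real (- f a / 2) + of_real (f a) \<in> Q"
      by (simp only: diff_diff_eq2 diff_add_cancel)
    then have "- f a / 2 + f a \<ge> 0" by (intro Q_real) (simp only: of_real_add)
    with \<open>\<not> f a \<ge> 0\<close> show False by simp
  qed
  ultimately show thesis using that by blast
qed

text \<open>Once \<open>s p - 1 \<in> M\<close> and \<open>p + r \<in> M\<close>, one has for large \<open>k\<close> the identity
  \<open>k\<^sup>2 (p + r) - k = (k - s)\<^sup>2 (p + r) + 2 k (s p - 1) + r s (2 k - s) + (k - s\<^sup>2 p)\<close>, which lowers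
  \<open>r\<close> by \<open>1 / k\<close>.\<close>

lemma quadratic_module_mem_if_multiple:
  fixes M :: "'a::{comm_ring_1,real_algebra_1} set"
  assumes M: "quadratic_module M" "archimedean_module M"
    and s: "s \<in> sums_of_squares" "s * p - 1 \<in> M"
  shows "p \<in> M"
proof -
  note M_add = quadratic_module_add[OF M(1)]
  note M_real = quadratic_module_of_real[OF M(1)]
  note M_scale = quadratic_module_scale[OF M(1)]
  \<comment> \<open>Upward closed thresholds allow one \<open>k\<close> to meet several bounds at
    once.\<close>
  have bound: "\<exists>n::nat. \<forall>r\<ge>real n. of_real r - a \<in> M" for a
  proof -
    obtain t where t: "of_real t - a \<in> M" using M(2) by (auto simp: archimedean_module_def)
    obtain n where "t \<le> real n" using real_arch_simple by blast
    then have "of_real r - a \<in> M" if "r \<ge> real n" for r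
      using M_add[OF t M_real[of "r - t"]] that by simp
    then show ?thesis by blast
  qed
  obtain n1 where n1: "of_real r - s \<in> M" if "r \<ge> real n1" for r using bound by blast
  obtain n2 where n2: "of_real r - s\<^sup>2 * p \<in> M" if "r \<ge> real n2" for r using bound by blast
  \<comment> \<open>\<open>k\<close> exceeds both thresholds, and the summand \<open>1\<close> makes
    it positive.\<close>
  define k where "k = real (n1 + n2 + 1)"
  have k: "k > 0" by (simp add: k_def)
  have k1: "of_real (2 * k) - s \<in> M" and k2: "of_real k - s\<^sup>2 * p \<in> M"
    by (intro n1 n2; simp add: k_def)+
  have step: "p + of_real (r - 1 / k) \<in> M" if r: "r \<ge> 0" "p + of_real r \<in> M" for r
  proof -
    let ?k = "of_real k :: 'a" and ?r = "of_real r :: 'a"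
    have "(?k - s)\<^sup>2 * (p + ?r) + of_real (2 * k) * (s * p - 1)
        + of_real r * (s * (of_real (2 * k) - s)) + (?k - s\<^sup>2 * p) \<in> M"
      using k by (intro M_add[OF M_add[OF M_add]] M_scale r s k1 k2
          quadratic_module_mult_square[OF M(1)] quadratic_module_mult_sums_of_squares[OF M(1)]) simp
    also have "(?k - s)\<^sup>2 * (p + ?r) + of_real (2 * k) * (s * p - 1)
        + of_real r * (s * (of_real (2 * k) - s)) + (?k - s\<^sup>2 * p) = ?k * ?k * (p + ?r) - ?k"
      by (simp add: algebra_simps power2_eq_square)
    finally have "of_real (1 / k^2) * (?k * ?k * (p + ?r) - ?k) \<in> M"
      by (intro M_scale) auto
    moreover have "of_real (1 / k^2) * (?k * ?k) = (1 :: 'a)" "of_real (1 / k^2) * ?k = (of_real (1 / k) :: 'a)"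
      using k by (simp_all add: power2_eq_square flip: of_real_mult)
    then have "of_real (1 / k^2) * (?k * ?k * (p + ?r) - ?k) = p + of_real (r - 1 / k)"
      by (simp only: right_diff_distrib mult.assoc[symmetric] of_real_diff) (simp only: mult_1 add_diff_eq)
    ultimately show ?thesis by simp
  qed
  have descend: "p + of_real (real n / k) \<in> M \<Longrightarrow> p \<in> M" for n
  proof (induction n)
    case (Suc n)
    have "real (Suc n) / k - 1 / k = real n / k" by (simp add: add_divide_distrib)
    then show ?case
      using Suc.IH step[OF _ Suc.prems] k by simp
  qed simp
  obtain n where n: "of_real r - (- p) \<in> M" if "r \<ge> real n" for r using bound by blast
  \<comment> \<open>The descent starts at \<open>l / k\<close>, a multiple of the step length that
    is at least the bound \<open>n\<close> for \<open>-p\<close>, and reaches \<open>0\<close> after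
    \<open>l\<close> steps.\<close>
  obtain l :: nat where "real n * k \<le> real l" using real_arch_simple by blast
  then have "real n \<le> real l / k" using k by (simp add: field_simps)
  from n[OF this] show ?thesis
    by (intro descend[of l]) (simp add: add.commute)
qed

text \<open>Were \<open>-1\<close> outside \<open>?N\<close>, a character nonnegative on
  \<open>?N\<close> would be nonnegative on \<open>M\<close> and nonpositive at \<open>p\<close>. So
  \<open>-1 = m - s * p\<close>, and the previous lemma removes the multiplier
  \<open>s\<close>.\<close>

theorem representation_theorem:
  fixes M :: "'a::{comm_ring_1,real_algebra_1} set"
  assumes M: "quadratic_module M" "archimedean_module M"
    and pos: "\<And>f. real_character f \<Longrightarrow> (\<And>a. a \<in> M \<Longrightarrow> f a \<ge> 0) \<Longrightarrow> f p > 0"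
  shows "p \<in> M"
proof -
  let ?N = "{m + s * (- p) | m s. m \<in> M \<and> s \<in> sums_of_squares}"
  have sub: "M \<subseteq> ?N" using sums_of_squares.zero by force
  have "-1 \<in> ?N"
  proof (rule ccontr)
    assume "-1 \<notin> ?N"
    moreover have "archimedean_module ?N"
      using M(2) sub unfolding archimedean_module_def by blast
    ultimately obtain f where f: "real_character f" "\<And>a. a \<in> ?N \<Longrightarrow> f a \<ge> 0"
      using exists_character[OF quadratic_module_adjoin[OF M(1)]] by blast
    have "0 + 1\<^sup>2 * (- p) \<in> ?N"
      using quadratic_module_zero[OF M(1)] square_in_sums_of_squares by blast
    then have "f (- p) \<ge> 0" using f(2) by simp
    moreover have "f p > 0" using pos f sub by blast
    ultimately show False by (simp add: real_character_minus[OF f(1)])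
  qed
  then obtain m s where "m \<in> M" "s \<in> sums_of_squares" "-1 = m + s * (- p)" by blast
  moreover from this have "s * p - 1 = m" by (simp add: algebra_simps)
  ultimately show ?thesis using quadratic_module_mem_if_multiple[OF M] by metis
qed

section \<open>The ring of bounded elements\<close>

text \<open>To prove \<open>M\<close> archimedean it suffices to bound ring generators, since these
  elements form a subring. The radius is positive as \<open>quadratic_module_bound_square\<close>
  demands.\<close>

definition bounded_by :: "'a::{comm_ring_1,real_algebra_1} set \<Rightarrow> 'a set" where
  "bounded_by M = {a. \<exists>r>0. of_real r + a \<in> M \<and> of_real r - a \<in> M}"

context
  fixes M :: "'a::{comm_ring_1,real_algebra_1} set"
  assumes M: "quadratic_module M"
begin

lemma bounded_by_of_real: "of_real c \<in> bounded_by M"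
proof -
  have "of_real (\<bar>c\<bar> + 1 + c) \<in> M" "of_real (\<bar>c\<bar> + 1 - c) \<in> M"
    by (intro quadratic_module_of_real[OF M]; simp)+
  then show ?thesis
    unfolding bounded_by_def
    by (intro CollectI exI[of _ "\<bar>c\<bar> + 1"]) (simp add: add.assoc)
qed

lemma bounded_by_add:
  assumes "a \<in> bounded_by M" "b \<in> bounded_by M"
  shows "a + b \<in> bounded_by M"
proof -
  obtain r s where rs: "r > 0" "of_real r + a \<in> M" "of_real r - a \<in> M"
    "s > 0" "of_real s + b \<in> M" "of_real s - b \<in> M"
    using assms by (auto simp: bounded_by_def)
  from quadratic_module_add[OF M rs(2,5)] quadratic_module_add[OF M rs(3,6)] rs(1,4) show ?thesis
    unfolding bounded_by_def by (intro CollectI exI[of _ "r + s"]) (simp add: algebra_simps)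
qed

lemma bounded_by_minus: "a \<in> bounded_by M \<Longrightarrow> - a \<in> bounded_by M"
  by (auto simp: bounded_by_def)

lemma bounded_by_square:
  assumes "a \<in> bounded_by M"
  shows "a\<^sup>2 \<in> bounded_by M"
proof -
  obtain r where r: "r > 0" "of_real r + a \<in> M" "of_real r - a \<in> M"
    using assms by (auto simp: bounded_by_def)
  have "of_real (r\<^sup>2) + a\<^sup>2 \<in> M"
    by (intro quadratic_module_add[OF M] quadratic_module_of_real[OF M] quadratic_module_square[OF M]) simp
  then show ?thesis
    using r(1) quadratic_module_bound_square[OF M r] unfolding bounded_by_def
    by (intro CollectI exI[of _ "r\<^sup>2"]) simp
qed

lemma bounded_by_scale:
  assumes "a \<in> bounded_by M" "c > 0"
  shows "of_real c * a \<in> bounded_by M"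
proof -
  obtain r where r: "r > 0" "of_real r + a \<in> M" "of_real r - a \<in> M"
    using assms by (auto simp: bounded_by_def)
  have "of_real c * (of_real r + a) \<in> M" "of_real c * (of_real r - a) \<in> M"
    using assms(2) r by (auto intro!: quadratic_module_scale[OF M])
  then show ?thesis
    using r(1) assms(2) unfolding bounded_by_def
    by (intro CollectI exI[of _ "c * r"]) (simp add: distrib_left right_diff_distrib)
qed

lemma bounded_by_mult:
  assumes "a \<in> bounded_by M" "b \<in> bounded_by M"
  shows "a * b \<in> bounded_by M"
proof -
  have "of_real (1/4) * ((a + b)\<^sup>2 + - (a + - b)\<^sup>2) \<in> bounded_by M"
    by (intro bounded_by_scale bounded_by_add bounded_by_minus bounded_by_square assms) simp
  also have "(a + b)\<^sup>2 + - (a + - b)\<^sup>2 = of_real 4 * (a * b)"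
    by (simp add: algebra_simps power2_eq_square)
  also have "of_real (1/4) * (of_real 4 * (a * b)) = a * b"
    by (rule of_real_inverse_mult) simp
  finally show ?thesis .
qed

lemma bounded_by_power: "a \<in> bounded_by M \<Longrightarrow> a ^ n \<in> bounded_by M"
  using bounded_by_of_real[of 1] by (induction n) (simp_all add: bounded_by_mult)

lemma bounded_by_prod: "(\<And>i. i \<in> S \<Longrightarrow> a i \<in> bounded_by M) \<Longrightarrow> (\<Prod>i\<in>S. a i) \<in> bounded_by M"
  using bounded_by_of_real[of 1]
  by (induction S rule: infinite_finite_induct) (simp_all add: bounded_by_mult)

text \<open>Completing the square: adding \<open>(1/2 + b)\<^sup>2\<close> to
  \<open>r - a\<^sup>2\<close> gives \<open>r + 1/4 + b\<close> for \<open>b = a\<close> and for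
  \<open>b = -a\<close>.\<close>

lemma bounded_by_if_square_bounded:
  assumes "of_real r - a\<^sup>2 \<in> M" "r > 0"
  shows "a \<in> bounded_by M"
proof -
  let ?h = "of_real (1/2) :: 'a"
  have h: "?h + ?h = 1" "?h * ?h = of_real (1/4)"
    by (simp_all only: of_real_add[symmetric] of_real_mult[symmetric]) simp_all
  have *: "(of_real r - a\<^sup>2) + (?h + b)\<^sup>2 = of_real (r + 1/4) + b" if "b\<^sup>2 = a\<^sup>2" for b
  proof -
    have "(?h + b)\<^sup>2 = ?h * ?h + (?h + ?h) * b + b\<^sup>2"
      by (simp only: power2_eq_square algebra_simps)
    then show ?thesis unfolding h that of_real_add by simp
  qed
  have "(of_real r - a\<^sup>2) + (?h + b)\<^sup>2 \<in> M" for b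
    by (intro quadratic_module_add[OF M] assms quadratic_module_square[OF M])
  from this[of a] this[of "- a"] have "of_real (r + 1/4) + a \<in> M" "of_real (r + 1/4) + - a \<in> M"
    by (simp_all only: * power2_minus)
  then show ?thesis
    unfolding bounded_by_def using assms(2) by (intro CollectI exI[of _ "r + 1/4"]) simp
qed

end

section \<open>Real polynomials and their characters\<close>

text \<open>Suits statements additive in \<open>p\<close>: the step allows any \<open>a\<close>,
  whether or not it is already a key of \<open>p\<close>.\<close>

lemma poly_mapping_single_induct [case_names zero single_add]:
  assumes "P 0" "\<And>a r p. P p \<Longrightarrow> P (Poly_Mapping.single a r + p)"
  shows "P (p :: 'a \<Rightarrow>\<^sub>0 'b::comm_monoid_add)"
proof (induction p rule: update_induct)
  case (update p a r)
  then have "Poly_Mapping.update a r p = Poly_Mapping.single a r + p"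
    by (intro poly_mapping_eqI)
      (auto simp: lookup_update lookup_add lookup_single when_def not_in_keys_iff_lookup_eq_zero)
  with update assms(2) show ?case by simp
qed (fact assms(1))

lemma lookup_scaleR [simp]:
  "Poly_Mapping.lookup (r *\<^sub>R p) a = r *\<^sub>R Poly_Mapping.lookup p a"
proof -
  have "finite {i. r *\<^sub>R Poly_Mapping.lookup p i \<noteq> 0}"
    by (rule finite_subset[OF _ finite_keys[of p]]) (auto simp: in_keys_iff)
  then show ?thesis by (simp add: scaleR_poly_mapping_def)
qed

lemma scaleR_single: "r *\<^sub>R Poly_Mapping.single a b = Poly_Mapping.single a (r *\<^sub>R b)"
  by (intro poly_mapping_eqI) (simp add: lookup_single when_def)

text \<open>Both scalar laws are additive in each factor, so single terms suffice. The instance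
  makes the abstract theory apply to \<open>rpoly\<close>.\<close>

instance poly_mapping :: (monoid_add, real_algebra_1) real_algebra_1
proof
  fix r :: real and x y :: "'a \<Rightarrow>\<^sub>0 'b"
  have *: "(r *\<^sub>R Poly_Mapping.single a b) * y = r *\<^sub>R (Poly_Mapping.single a b * y) \<and>
      Poly_Mapping.single a b * (r *\<^sub>R y) = r *\<^sub>R (Poly_Mapping.single a b * y)" for a b
    by (induction y rule: poly_mapping_single_induct)
      (simp_all add: distrib_left scaleR_add_right scaleR_single mult_single)
  have "(r *\<^sub>R x) * y = r *\<^sub>R (x * y) \<and> x * (r *\<^sub>R y) = r *\<^sub>R (x * y)"
    by (induction x rule: poly_mapping_single_induct)
      (simp_all add: distrib_right scaleR_add_right *)
  then show "(r *\<^sub>R x) * y = r *\<^sub>R (x * y)" "x * (r *\<^sub>R y) = r *\<^sub>R (x * y)" by auto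
qed

lemma of_real_poly_mapping:
  "(of_real r :: 'a::monoid_add \<Rightarrow>\<^sub>0 'b::real_algebra_1) = Poly_Mapping.single 0 (of_real r)"
  by (simp add: of_real_def scaleR_single flip: single_one)

lemma const_poly_eq_of_real: "const_poly r = of_real r"
  by (simp add: const_poly_def of_real_poly_mapping)

lemma var_poly_power: "var_poly i ^ n = Poly_Mapping.single (Poly_Mapping.single i n) 1"
  by (induction n) (simp_all add: var_poly_def monomial_def mult_single flip: single_add)

lemma prod_single_one:
  "finite S \<Longrightarrow> (\<Prod>i\<in>S. Poly_Mapping.single (b i) 1) =
     (Poly_Mapping.single (\<Sum>i\<in>S. b i) 1 :: 'a::comm_monoid_add \<Rightarrow>\<^sub>0 'b::comm_semiring_1)"
  by (induction S rule: finite_induct) (simp_all add: mult_single)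

text \<open>Constants and variables generate the ring; characters and bounds thus need to be known
  only on variables.\<close>

lemma single_eq_prod_var_poly:
  "Poly_Mapping.single a r = of_real r * (\<Prod>i\<in>UNIV. var_poly i ^ Poly_Mapping.lookup a i)"
proof -
  have "(\<Sum>i\<in>UNIV. Poly_Mapping.single i (Poly_Mapping.lookup a i)) = a"
    by (intro poly_mapping_eqI) (simp add: lookup_sum lookup_single when_def)
  then show ?thesis
    by (simp add: var_poly_power prod_single_one of_real_poly_mapping mult_single)
qed

lemma eval_poly_add: "eval_poly (p + q) u = eval_poly p u + eval_poly q u"
  unfolding eval_poly_def by (rule setsum_keys_plus_distrib) (simp_all add: distrib_right)

lemma eval_poly_single:
  "eval_poly (Poly_Mapping.single a r) u = r * (\<Prod>i\<in>UNIV. (u $ i) ^ Poly_Mapping.lookup a i)"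
  by (simp add: eval_poly_def)

lemma eval_poly_zero [simp]: "eval_poly 0 u = 0"
  by (simp add: eval_poly_def)

lemma eval_poly_mult: "eval_poly (p * q) u = eval_poly p u * eval_poly q u"
proof -
  have *: "eval_poly (Poly_Mapping.single a r * q) u = eval_poly (Poly_Mapping.single a r) u * eval_poly q u"
    for a r
    by (induction q rule: poly_mapping_single_induct)
      (simp_all add: distrib_left eval_poly_add mult_single eval_poly_single lookup_add power_add prod.distrib)
  show ?thesis
    by (induction p rule: poly_mapping_single_induct) (simp_all add: distrib_right eval_poly_add *)
qed

lemma real_character_eval_poly: "real_character (\<lambda>p. eval_poly p u)"
  by (simp add: real_character_def eval_poly_add eval_poly_mult of_real_poly_mapping eval_poly_single)

text \<open>A character fixes constants, so its values on the variables determine it; they are the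
  coordinates of the point.\<close>

lemma real_character_rpoly:
  fixes f :: "'n::finite rpoly \<Rightarrow> real"
  assumes "real_character f"
  shows "f p = eval_poly p (\<chi> i. f (var_poly i))"
proof (induction p rule: poly_mapping_single_induct)
  case (single_add a r p)
  have "f (Poly_Mapping.single a r) = r * (\<Prod>i\<in>UNIV. f (var_poly i) ^ Poly_Mapping.lookup a i)"
    using assms by (simp add: single_eq_prod_var_poly real_character_mult real_character_of_real
        real_character_prod real_character_power)
  with single_add show ?case
    using assms by (simp add: real_character_add eval_poly_add eval_poly_single)
qed (simp add: real_character_zero assms)

section \<open>Truncated ideals and quadratic modules\<close>

lemma sos_eq_sums_of_squares: "sos = sums_of_squares"
proof (intro equalityI subsetI)
  fix s :: "'a rpoly" assume "s \<in> sos"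
  then obtain m :: nat and q where "s = (\<Sum>i<m. (q i)\<^sup>2)" by (auto simp: sos_def)
  moreover have "(\<Sum>i<m. (q i)\<^sup>2) \<in> sums_of_squares"
    by (induction m) (simp_all add: sums_of_squares.intros)
  ultimately show "s \<in> sums_of_squares" by simp
next
  fix s :: "'a rpoly" assume "s \<in> sums_of_squares"
  then show "s \<in> sos"
  proof induction
    case zero
    show ?case unfolding sos_def by (auto intro!: exI[of _ "0::nat"])
  next
    case (add_square s a)
    then obtain m :: nat and q where "s = (\<Sum>i<m. (q i)\<^sup>2)" by (auto simp: sos_def)
    then have "s + a\<^sup>2 = (\<Sum>i<Suc m. ((q(m := a)) i)\<^sup>2)" by simp
    then show ?case unfolding sos_def by blast
  qed
qed

lemma polys_upto_mono: "d \<le> d' \<Longrightarrow> polys_upto d \<subseteq> polys_upto d'"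
  by (auto simp: polys_upto_def)

lemma trunc_ideal_mono:
  assumes "l \<le> l'"
  shows "trunc_ideal l h \<subseteq> trunc_ideal l' h"
proof -
  have "polys_upto (int l - int d) \<subseteq> polys_upto (int l' - int d)" for d
    using assms by (intro polys_upto_mono) simp
  then show ?thesis unfolding trunc_ideal_def by blast
qed

lemma trunc_qmodule_mono:
  assumes "k \<le> k'"
  shows "trunc_qmodule k g \<subseteq> trunc_qmodule k' g"
proof -
  have "sos_upto (2 * int k - int d) \<subseteq> sos_upto (2 * int k' - int d)" for d
    using assms unfolding sos_upto_def by (intro Int_mono polys_upto_mono) auto
  moreover from this[of 0] have "sos_upto (2 * int k) \<subseteq> sos_upto (2 * int k')" by simp
  ultimately show ?thesis unfolding trunc_qmodule_def by blast
qed

text \<open>The degree bounds disappear in the union, since finitely many multipliers fit into some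
  level.\<close>

lemma poly_ideal_eq: "poly_ideal h = {\<Sum>j<length h. h ! j * q j | q. True}"
proof (intro equalityI subsetI)
  fix p assume "p \<in> {\<Sum>j<length h. h ! j * q j | q. True}"
  then obtain q where p: "p = (\<Sum>j<length h. h ! j * q j)" by blast
  define k where "k = (\<Sum>j<length h. total_deg (q j) + total_deg (h ! j))"
  have "total_deg (q j) + total_deg (h ! j) \<le> k" if "j < length h" for j
    unfolding k_def by (rule member_le_sum) (use that in auto)
  then have "\<forall>j<length h. q j \<in> polys_upto (int (2 * k) - int (total_deg (h ! j)))"
    by (force simp: polys_upto_def)
  then show "p \<in> poly_ideal h"
    unfolding poly_ideal_def trunc_ideal_def p by blast
qed (auto simp: poly_ideal_def trunc_ideal_def)

lemma qmodule_eq: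
  "qmodule g = {s + (\<Sum>j<length g. g ! j * t j) | s t.
     s \<in> sums_of_squares \<and> (\<forall>j<length g. t j \<in> sums_of_squares)}" (is "_ = ?Q")
proof (intro equalityI subsetI)
  fix p assume "p \<in> ?Q"
  then obtain s t where p: "p = s + (\<Sum>j<length g. g ! j * t j)"
    and st: "s \<in> sums_of_squares" "\<forall>j<length g. t j \<in> sums_of_squares" by blast
  \<comment> \<open>The sum of all degrees involved dominates each single degree
    requirement.\<close>
  define k where "k = total_deg s + (\<Sum>j<length g. total_deg (t j) + total_deg (g ! j))"
  have "total_deg (t j) + total_deg (g ! j) \<le> (\<Sum>j<length g. total_deg (t j) + total_deg (g ! j))"
    if "j < length g" for j
    by (rule member_le_sum) (use that in auto)
  then have "total_deg (t j) + total_deg (g ! j) \<le> k" if "j < length g" for j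
    using that by (force simp: k_def)
  then have "\<forall>j<length g. t j \<in> sos_upto (2 * int k - int (total_deg (g ! j)))"
    using st by (force simp: polys_upto_def sos_upto_def sos_eq_sums_of_squares)
  moreover have "s \<in> sos_upto (2 * int k)"
  proof -
    have "total_deg s \<le> k" by (simp add: k_def)
    then show ?thesis using st by (simp add: polys_upto_def sos_upto_def sos_eq_sums_of_squares)
  qed
  ultimately show "p \<in> qmodule g"
    unfolding qmodule_def trunc_qmodule_def p by blast
next
  fix p assume "p \<in> qmodule g"
  then show "p \<in> ?Q"
    unfolding qmodule_def trunc_qmodule_def sos_upto_def sos_eq_sums_of_squares by blast
qed

text \<open>This names the set in \<open>archimedean_pair\<close>, to which the abstract theory is
  applied as \<open>M\<close>.\<close>

definition ideal_plus_qmodule :: "'n::finite rpoly list \<Rightarrow> 'n rpoly list \<Rightarrow> 'n rpoly set" where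
  "ideal_plus_qmodule h g = {p + q | p q. p \<in> poly_ideal h \<and> q \<in> qmodule g}"

lemma ideal_plus_qmodule_eq_UN:
  "ideal_plus_qmodule h g =
     (\<Union>k\<in>{1..}. {q + r | q r. q \<in> trunc_qmodule k g \<and> r \<in> trunc_ideal (2 * k) h})"
proof (intro equalityI subsetI)
  fix p assume "p \<in> ideal_plus_qmodule h g"
  then obtain q r k l where p: "p = r + q" "q \<in> trunc_qmodule k g" "r \<in> trunc_ideal (2 * l) h"
    unfolding ideal_plus_qmodule_def poly_ideal_def qmodule_def by blast
  \<comment> \<open>The maximum serves both summands by monotonicity; \<open>Suc\<close> makes the
    index at least \<open>1\<close>.\<close>
  let ?m = "Suc (max k l)"
  have "q \<in> trunc_qmodule ?m g" "r \<in> trunc_ideal (2 * ?m) h"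
    by (rule subsetD[OF trunc_qmodule_mono p(2)] subsetD[OF trunc_ideal_mono p(3)]; simp)+
  moreover have "p = q + r" "?m \<in> {1..}" using p(1) by (simp_all add: add.commute)
  ultimately show "p \<in> (\<Union>k\<in>{1..}. {q + r | q r. q \<in> trunc_qmodule k g \<and> r \<in> trunc_ideal (2 * k) h})"
    by blast
next
  fix p assume "p \<in> (\<Union>k\<in>{1..}. {q + r | q r. q \<in> trunc_qmodule k g \<and> r \<in> trunc_ideal (2 * k) h})"
  then obtain k q r where "p = r + q" "q \<in> trunc_qmodule k g" "r \<in> trunc_ideal (2 * k) h"
    by (auto simp: add.commute)
  then show "p \<in> ideal_plus_qmodule h g"
    unfolding ideal_plus_qmodule_def poly_ideal_def qmodule_def by blast
qed

lemma poly_ideal_add: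
  assumes "p \<in> poly_ideal h" "q \<in> poly_ideal h"
  shows "p + q \<in> poly_ideal h"
proof -
  obtain r s where "p = (\<Sum>j<length h. h ! j * r j)" "q = (\<Sum>j<length h. h ! j * s j)"
    using assms unfolding poly_ideal_eq by blast
  then have "p + q = (\<Sum>j<length h. h ! j * (r j + s j))" by (simp add: distrib_left sum.distrib)
  then show ?thesis unfolding poly_ideal_eq by (intro CollectI exI[of _ "\<lambda>j. r j + s j"]) simp
qed

lemma poly_ideal_mult:
  assumes "p \<in> poly_ideal h"
  shows "q * p \<in> poly_ideal h"
proof -
  obtain r where "p = (\<Sum>j<length h. h ! j * r j)" using assms unfolding poly_ideal_eq by blast
  then have "q * p = (\<Sum>j<length h. h ! j * (q * r j))" by (simp add: sum_distrib_left mult_ac)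
  then show ?thesis unfolding poly_ideal_eq by (intro CollectI exI[of _ "\<lambda>j. q * r j"]) simp
qed

lemma poly_ideal_zero: "0 \<in> poly_ideal h"
  unfolding poly_ideal_eq by (auto intro!: exI[of _ "\<lambda>_. 0"])

lemma poly_ideal_nth:
  assumes "i < length h"
  shows "h ! i \<in> poly_ideal h"
proof -
  have "h ! i = (\<Sum>j<length h. h ! j * (if j = i then 1 else 0))"
    using assms by (simp add: if_distrib[of "times _"] cong: if_cong)
  then show ?thesis
    unfolding poly_ideal_eq by (intro CollectI exI[of _ "\<lambda>j. if j = i then 1 else 0"]) simp
qed

lemma quadratic_module_qmodule: "quadratic_module (qmodule g)"
proof -
  have "1 + (\<Sum>j<length g. g ! j * 0) \<in> qmodule g"
    unfolding qmodule_eq using square_in_sums_of_squares[of 1] sums_of_squares.zero by force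
  moreover have "p + q \<in> qmodule g" if pq: "p \<in> qmodule g" "q \<in> qmodule g" for p q
  proof -
    obtain s t s' t' where *: "p = s + (\<Sum>j<length g. g ! j * t j)" "q = s' + (\<Sum>j<length g. g ! j * t' j)"
      "s \<in> sums_of_squares" "\<forall>j<length g. t j \<in> sums_of_squares"
      "s' \<in> sums_of_squares" "\<forall>j<length g. t' j \<in> sums_of_squares"
      using pq unfolding qmodule_eq by blast
    have "p + q = (s + s') + (\<Sum>j<length g. g ! j * (t j + t' j))"
      by (simp add: * distrib_left sum.distrib)
    moreover have "s + s' \<in> sums_of_squares" "\<forall>j<length g. t j + t' j \<in> sums_of_squares"
      using * by (auto intro: sums_of_squares_add)
    ultimately show ?thesis
      unfolding qmodule_eq by (intro CollectI exI[of _ "s + s'"] exI[of _ "\<lambda>j. t j + t' j"]) simp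
  qed
  moreover have "a\<^sup>2 * p \<in> qmodule g" if p: "p \<in> qmodule g" for a p
  proof -
    obtain s t where *: "p = s + (\<Sum>j<length g. g ! j * t j)"
      "s \<in> sums_of_squares" "\<forall>j<length g. t j \<in> sums_of_squares"
      using p unfolding qmodule_eq by blast
    have "a\<^sup>2 * p = a\<^sup>2 * s + (\<Sum>j<length g. g ! j * (a\<^sup>2 * t j))"
      by (simp add: * distrib_left sum_distrib_left mult_ac)
    moreover have "a\<^sup>2 * s \<in> sums_of_squares" "\<forall>j<length g. a\<^sup>2 * t j \<in> sums_of_squares"
      using * by (auto intro: sums_of_squares_mult_square)
    ultimately show ?thesis
      unfolding qmodule_eq by (intro CollectI exI[of _ "a\<^sup>2 * s"] exI[of _ "\<lambda>j. a\<^sup>2 * t j"]) simp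
  qed
  ultimately show ?thesis by (simp add: quadratic_module_def)
qed

lemma qmodule_nth:
  fixes g :: "'a::finite rpoly list"
  assumes "i < length g"
  shows "g ! i \<in> qmodule g"
proof -
  have "g ! i = 0 + (\<Sum>j<length g. g ! j * (if j = i then 1 else 0))"
    using assms by (simp add: if_distrib[of "times _"] cong: if_cong)
  moreover have "\<forall>j<length g. (if j = i then 1 else 0 :: 'a rpoly) \<in> sums_of_squares"
    using square_in_sums_of_squares[of "1 :: 'a rpoly"] by (simp add: sums_of_squares.zero)
  ultimately show ?thesis
    unfolding qmodule_eq using sums_of_squares.zero
    by (intro CollectI exI[of _ 0] exI[of _ "\<lambda>j. if j = i then 1 else 0"]) simp
qed

lemma poly_ideal_subset: "poly_ideal h \<subseteq> ideal_plus_qmodule h g"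
  unfolding ideal_plus_qmodule_def using quadratic_module_zero[OF quadratic_module_qmodule] by force

lemma qmodule_subset: "qmodule g \<subseteq> ideal_plus_qmodule h g"
  unfolding ideal_plus_qmodule_def using poly_ideal_zero by force

lemma quadratic_module_ideal_plus_qmodule: "quadratic_module (ideal_plus_qmodule h g)"
proof -
  note qm = quadratic_module_qmodule[of g]
  have "1 \<in> ideal_plus_qmodule h g"
    using qmodule_subset quadratic_module_one[OF qm] by blast
  moreover have "x + y \<in> ideal_plus_qmodule h g"
    if xy: "x \<in> ideal_plus_qmodule h g" "y \<in> ideal_plus_qmodule h g" for x y
  proof -
    obtain p q p' q' where *: "x = p + q" "y = p' + q'" "p \<in> poly_ideal h" "p' \<in> poly_ideal h"
      "q \<in> qmodule g" "q' \<in> qmodule g"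
      using xy unfolding ideal_plus_qmodule_def by blast
    then have "x + y = (p + p') + (q + q')" by simp
    with * show ?thesis
      unfolding ideal_plus_qmodule_def using poly_ideal_add quadratic_module_add[OF qm] by blast
  qed
  moreover have "a\<^sup>2 * x \<in> ideal_plus_qmodule h g" if "x \<in> ideal_plus_qmodule h g" for a x
    using that unfolding ideal_plus_qmodule_def
    using poly_ideal_mult[of _ h "a\<^sup>2"] quadratic_module_mult_square[OF qm, of _ a]
    by (fastforce simp: distrib_left)
  ultimately show ?thesis unfolding quadratic_module_def by blast
qed

section \<open>Characters, points of the semialgebraic set, and the two inclusions\<close>

text \<open>The ideal part is sent to \<open>0\<close> and all other terms to nonnegative numbers.
  For evaluations at points of \<open>K\<close> this is the second inclusion.\<close>

lemma real_character_ideal_plus_qmodule: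
  assumes "real_character f" "\<And>j. j < length h \<Longrightarrow> f (h ! j) = 0"
    "\<And>j. j < length g \<Longrightarrow> f (g ! j) \<ge> 0" "p \<in> ideal_plus_qmodule h g"
  shows "f p \<ge> 0"
proof -
  obtain q s t where p: "p = (\<Sum>j<length h. h ! j * q j) + (s + (\<Sum>j<length g. g ! j * t j))"
    and st: "s \<in> sums_of_squares" "\<forall>j<length g. t j \<in> sums_of_squares"
    using assms(4) unfolding ideal_plus_qmodule_def poly_ideal_eq qmodule_eq by blast
  have "f p = f s + (\<Sum>j<length g. f (g ! j) * f (t j))"
    using assms by (simp add: p real_character_add real_character_sum real_character_mult)
  also have "\<dots> \<ge> 0"
    using assms(1,3) st by (intro add_nonneg_nonneg sum_nonneg mult_nonneg_nonneg)
      (auto intro: real_character_sums_of_squares)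
  finally show ?thesis .
qed

text \<open>The module contains each \<open>h ! j\<close> together with its negative, which forces
  \<open>f (h ! j) = 0\<close>.\<close>

lemma nonneg_character_on_semialg_set:
  assumes f: "real_character f" and nonneg: "\<And>p. p \<in> ideal_plus_qmodule h g \<Longrightarrow> f p \<ge> 0"
  shows "(\<chi> i. f (var_poly i)) \<in> semialg_set h g"
proof -
  have "f (h ! j) = 0" if "j < length h" for j
  proof -
    have "h ! j \<in> ideal_plus_qmodule h g" "(- 1) * h ! j \<in> ideal_plus_qmodule h g"
      using poly_ideal_subset poly_ideal_nth[OF that] poly_ideal_mult by blast+
    from this[THEN nonneg] show ?thesis by (simp add: real_character_minus[OF f])
  qed
  moreover have "f (g ! j) \<ge> 0" if "j < length g" for j
    using nonneg qmodule_subset qmodule_nth[OF that] by blast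
  ultimately show ?thesis
    by (simp add: semialg_set_def flip: real_character_rpoly[OF f])
qed

lemma archimedean_module_rpolyI:
  fixes M :: "'n::finite rpoly set"
  assumes M: "quadratic_module M" and R: "R > 0" "of_real R - (\<Sum>i\<in>UNIV. (var_poly i)\<^sup>2) \<in> M"
  shows "archimedean_module M"
proof -
  have var: "var_poly i \<in> bounded_by M" for i
  proof (rule bounded_by_if_square_bounded[OF M _ R(1)])
    have *: "(\<Sum>j\<in>S. (var_poly j)\<^sup>2) \<in> M" for S :: "'n set"
      by (induction S rule: infinite_finite_induct)
        (simp_all add: quadratic_module_zero[OF M] quadratic_module_add[OF M] quadratic_module_square[OF M])
    \<comment> \<open>Adding back the other squares isolates a bound on one variable.\<close>
    have "of_real R - (var_poly i)\<^sup>2 =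
        (of_real R - (\<Sum>i\<in>UNIV. (var_poly i)\<^sup>2)) + (\<Sum>j\<in>UNIV - {i}. (var_poly j)\<^sup>2)"
      by (subst sum.remove[of UNIV i]) auto
    then show "of_real R - (var_poly i)\<^sup>2 \<in> M"
      using quadratic_module_add[OF M R(2) *] by metis
  qed
  have "p \<in> bounded_by M" for p
  proof (induction p rule: poly_mapping_single_induct)
    case zero
    show ?case using bounded_by_of_real[OF M, of 0] by simp
  next
    case (single_add a r p)
    have "Poly_Mapping.single a r \<in> bounded_by M"
      unfolding single_eq_prod_var_poly
      by (intro bounded_by_mult[OF M] bounded_by_of_real[OF M] bounded_by_prod[OF M]
          bounded_by_power[OF M] var)
    with single_add show ?case by (intro bounded_by_add[OF M])
  qed
  then show ?thesis
    unfolding archimedean_module_def bounded_by_def by blast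
qed

text \<open>Characters nonnegative on the module are evaluations at points of
  \<open>semialg_set h g\<close>, so \<open>pos\<close> supplies the hypothesis of the
  representation theorem.\<close>

theorem Putinar_Positivstellensatz:
  assumes arch: "archimedean_pair h g"
    and pos: "\<And>u. u \<in> semialg_set h g \<Longrightarrow> eval_poly p u > 0"
  shows "p \<in> ideal_plus_qmodule h g"
proof (rule representation_theorem[OF quadratic_module_ideal_plus_qmodule])
  show "archimedean_module (ideal_plus_qmodule h g)"
    using arch archimedean_module_rpolyI[OF quadratic_module_ideal_plus_qmodule]
    unfolding archimedean_pair_def ideal_plus_qmodule_def[symmetric] const_poly_eq_of_real by blast
next
  fix f :: "'a rpoly \<Rightarrow> real"
  assume f: "real_character f" "\<And>a. a \<in> ideal_plus_qmodule h g \<Longrightarrow> f a \<ge> 0"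
  then show "f p > 0"
    using pos[OF nonneg_character_on_semialg_set] real_character_rpoly[OF f(1)] by metis
qed

lemma interior_nonneg_cone_pos:
  assumes full: "full_on A K"
    and p: "p \<in> (top_of_set (polys_supp A)) interior_of (nonneg_cone A K)"
    and u: "u \<in> K"
  shows "eval_poly p u > 0"
proof -
  obtain q where q: "q \<in> polys_supp A" "\<And>u. u \<in> K \<Longrightarrow> eval_poly q u > 0"
    using full by (auto simp: full_on_def)
  obtain T where T: "openin (top_of_set (polys_supp A)) T" "p \<in> T" "T \<subseteq> nonneg_cone A K"
    using p by (auto simp: interior_of_def)
  then obtain U where U: "open U" "T = polys_supp A \<inter> U"
    by (auto simp: openin_open)
  \<comment> \<open>As \<open>e\<close> decreases to \<open>0\<close>,
    \<open>p - e *\<^sub>R q\<close> tends to \<open>p\<close> and hence enters \<open>U\<close> for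
    some \<open>e > 0\<close>; it stays in the span, where the interior is taken.\<close>
  have "((\<lambda>e. p - e *\<^sub>R q) \<longlongrightarrow> p - 0 *\<^sub>R q) (at_right 0)"
    by (intro tendsto_intros)
  then have "\<forall>\<^sub>F e in at_right 0. p - e *\<^sub>R q \<in> U"
    using U T by (intro topological_tendstoD) auto
  then obtain e where e: "e > 0" "p - e *\<^sub>R q \<in> U"
    unfolding eventually_at_right_field by (metis dense)
  have "p - e *\<^sub>R q \<in> polys_supp A"
    using q(1) T U unfolding polys_supp_def by (intro span_diff span_scale) auto
  with e U T have "eval_poly (p - e *\<^sub>R q) u \<ge> 0"
    using u by (auto simp: nonneg_cone_def)
  note char = real_character_eval_poly[of u]
  have "eval_poly p u = eval_poly (p - e *\<^sub>R q) u + eval_poly (of_real e * q) u"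
    by (simp add: scaleR_conv_of_real flip: eval_poly_add)
  also have "eval_poly (of_real e * q) u = e * eval_poly q u"
    using real_character_of_real[OF char] by (simp add: eval_poly_mult)
  also have "eval_poly (p - e *\<^sub>R q) u + \<dots> > 0"
    using \<open>eval_poly (p - e *\<^sub>R q) u \<ge> 0\<close> e q(2)[OF u] by (simp add: add_nonneg_pos)
  finally show ?thesis .
qed

theorem proposition3p5:
  fixes h g :: "'n::finite rpoly list"
    and A :: "('n \<Rightarrow>\<^sub>0 nat) set"
    and K :: "(real ^ 'n) set"
  assumes "K = semialg_set h g"
    and "K \<noteq> {}"
    and "finite A"
    and "full_on A K"
    and "archimedean_pair h g"
  shows "(top_of_set (polys_supp A)) interior_of (nonneg_cone A K) \<subseteq> (\<Union>k\<in>{1..}. qmodule_cone A h g k)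
    \<and> (\<Union>k\<in>{1..}. qmodule_cone A h g k) \<subseteq> nonneg_cone A K"
proof -
  \<comment> \<open>The support condition is the same at every level, so it can be taken out of the
    union.\<close>
  have cone: "(\<Union>k\<in>{1..}. qmodule_cone A h g k) = polys_supp A \<inter> ideal_plus_qmodule h g"
    unfolding ideal_plus_qmodule_eq_UN qmodule_cone_def by blast
  show ?thesis
    unfolding cone
  proof (intro conjI subsetI IntI)
    fix p assume p: "p \<in> (top_of_set (polys_supp A)) interior_of (nonneg_cone A K)"
    then show "p \<in> polys_supp A"
      using interior_of_subset by (fastforce simp: nonneg_cone_def)
    show "p \<in> ideal_plus_qmodule h g"
      using Putinar_Positivstellensatz[OF assms(5)] interior_nonneg_cone_pos[OF assms(4) p] assms(1)
      by blast
  next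
    fix p assume p: "p \<in> polys_supp A \<inter> ideal_plus_qmodule h g"
    have "eval_poly p u \<ge> 0" if "u \<in> K" for u
      using real_character_ideal_plus_qmodule[OF real_character_eval_poly, of h u g p] p that assms(1)
      by (auto simp: semialg_set_def)
    with p show "p \<in> nonneg_cone A K"
      by (auto simp: nonneg_cone_def)
  qed
qed

end
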